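(* Let $0 < s \leq 1$, let $K \subset \mathbb{R}^{2}$ be a compact set, and let $E_{0} \subset S^{1}$ be a set (with no regularity or measurability assumed) with Hausdorff dimension $\dim E_{0} > 1 - s$. Suppose that for every $e \in E_{0}$ the set $K$ contains the union of some $s$-dimensional family of line segments perpendicular to $e$; that is, for every $e \in E_{0}$ there exists a family $\mathcal{L}_{e}$ of line segments perpendicular to $e$ such that $\bigcup \mathcal{L}_{e} \subset K$ and $\mathcal{H}^{s}(\rho_{e}(\bigcup \mathcal{L}_{e})) > 0$. Then $\mathcal{L}^{2}(K) > 0$.
   Context: $S^{1}$ is the unit circle in $\mathbb{R}^{2}$, $\mathcal{L}^{2}$ is Lebesgue measure on $\mathbb{R}^{2}$, and $\mathcal{H}^{s}$ is the $s$-dimensional Hausdorff (outer) measure. For $e \in S^{1}$, $\rho_{e} \colon \mathbb{R}^{2} \to \mathbb{R}$ is the orthogonal projection $\rho_{e}(x) = x \cdot e$. Line segments are non-degenerate (of positive length). Given $e \in S^{1}$ and $s \in [0,1]$, a family $\mathcal{L}$ of line segments perpendicular to $e$ is called $s$-dimensional if its union $L = \bigcup \mathcal{L} \subset \mathbb{R}^{2}$ satisfies $\mathcal{H}^{s}(\rho_{e}(L)) > 0$. No measurability is imposed on $L$ or $\rho_{e}(L)$. *)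

theory Defs
  imports "HOL-Analysis.Analysis"
begin

(* The summand (diam U)^s of the Hausdorff sums, with the usual conventions that the empty
   set contributes 0 and that (diam U)^0 = 1 for nonempty U, so that s = 0 gives counting
   measure. They are spelled out because 0 powr 0 = 0. *)
definition diam_power :: "real \<Rightarrow> 'a::metric_space set \<Rightarrow> ennreal" where
  "diam_power s U =
     (if U = {} then 0 else if s = 0 then 1 else ennreal (diameter U powr s))"

(* Boundedness is required separately because diameter, being a real supremum, carries no
   information on unbounded sets. If A has no admissible cover, the infimum is top. *)
definition hausdorff_premeasure :: "real \<Rightarrow> real \<Rightarrow> 'a::metric_space set \<Rightarrow> ennreal" where
  "hausdorff_premeasure s \<delta> A =
     (INF U \<in> {U :: nat \<Rightarrow> 'a set. A \<subseteq> (\<Union>i. U i) \<and> (\<forall>i. bounded (U i) \<and> diameter (U i) \<le> \<delta>)}.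
        \<Sum>i. diam_power s (U i))"

(* An outer measure, defined on all sets; no normalising constant is included. *)
definition hausdorff_measure :: "real \<Rightarrow> 'a::metric_space set \<Rightarrow> ennreal" where
  "hausdorff_measure s A = (SUP \<delta> \<in> {0<..}. hausdorff_premeasure s \<delta> A)"

definition hausdorff_dim :: "'a::metric_space set \<Rightarrow> ennreal" where
  "hausdorff_dim A = Inf {ennreal t | t. 0 \<le> t \<and> hausdorff_measure t A = 0}"

definition proj :: "real^2 \<Rightarrow> real^2 \<Rightarrow> real" where
  "proj e x = x \<bullet> e"

definition perp_segment :: "real^2 \<Rightarrow> (real^2) set \<Rightarrow> bool" where
  "perp_segment e S \<longleftrightarrow>
     (\<exists>a b. a \<noteq> b \<and> S = closed_segment a b \<and> orthogonal (b - a) e)"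

definition s_dimensional_family :: "real \<Rightarrow> real^2 \<Rightarrow> (real^2) set set \<Rightarrow> bool" where
  "s_dimensional_family s e F \<longleftrightarrow>
     (\<forall>S\<in>F. perp_segment e S) \<and> hausdorff_measure s (proj e ` \<Union>F) > 0"

end

theory Submission
  imports Defs
begin

text \<open>This is the classical \<open>L\<^sup>2\<close> argument of Kaufman and Marstrand for projections, applied to
lines. A line perpendicular to \<open>dir \<theta>\<close> is a point \<open>(\<theta>, t)\<close> of the dual plane, \<open>t\<close> being its
offset. The hypotheses say that the lines containing a segment of \<open>K\<close> form a set
of dimension greater than one: the dimension of the directions exceeds \<open>1 - s\<close>, and in each direction
the offsets have dimension at least \<open>s\<close>. A measure \<open>\<mu>\<close> of growth exponent greater than one on this
set has finite energy of order one. Hence the superposition of the length measures of the lines, restricted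
to a disc and weighted by \<open>\<mu>\<close>, has an \<open>L\<^sup>2\<close> density, since two strips of width \<open>\<delta>\<close> at
angle \<open>r\<close> overlap in area about \<open>\<delta>\<^sup>2 / r\<close>. As each of the lines
meets \<open>K\<close> in positive length, this superposition gives positive mass to \<open>K\<close>, so \<open>K\<close> cannot be null.

Everything is carried out at a finite resolution \<open>\<delta> = (1/2) ^ N\<close> with finitely supported weights and with constants
independent of \<open>N\<close>. This avoids limits of measures and any question of measurability of \<open>E\<^sub>0\<close> or of
the segment families. Frostman weights at finite resolution exist on every set of
positive content (\<open>frostman_hausdorff\<close>); they are taken first on the directions and then separately on the offsets for each
chosen direction. The growth of the second family bounds how many thickened segments meet a given one
(\<open>rectangle_overlap\<close>), the growth of the first bounds the remaining potential (\<open>potential_le\<close>), and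
Cauchy--Schwarz (\<open>weighted_overlap_bound\<close>) gives a lower bound for the measure of every
\<open>\<delta>\<close>-neighbourhood of \<open>K\<close> (\<open>thickening_measure_ge\<close>). Since \<open>K\<close> is compact, its measure is the limit of
these. Countable subadditivity of the content first reduces to segments of length bounded below, slices of
content bounded below, and angles and offsets in fixed unit intervals.\<close>

section \<open>Hausdorff content\<close>

lemma hausdorff_premeasure_le_suminf:
  assumes "A \<subseteq> (\<Union>i. U i)" "\<And>i::nat. bounded (U i)" "\<And>i. diameter (U i) \<le> \<delta>"
  shows "hausdorff_premeasure s \<delta> A \<le> (\<Sum>i. diam_power s (U i))"
  unfolding hausdorff_premeasure_def using assms by (intro INF_lower) auto

lemma hausdorff_premeasure_mono:
  "A \<subseteq> B \<Longrightarrow> hausdorff_premeasure s \<delta> A \<le> hausdorff_premeasure s \<delta> B"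
  unfolding hausdorff_premeasure_def by (rule INF_superset_mono) auto

lemma hausdorff_premeasure_le_diam_power:
  assumes "bounded U" "diameter U \<le> \<delta>" "0 \<le> \<delta>"
  shows "hausdorff_premeasure s \<delta> U \<le> diam_power s U"
proof -
  let ?U = "\<lambda>i::nat. if i = 0 then U else {}"
  have "hausdorff_premeasure s \<delta> U \<le> (\<Sum>i. diam_power s (?U i))"
    by (rule hausdorff_premeasure_le_suminf) (use assms in \<open>auto split: if_splits\<close>)
  also have "\<dots> = (\<Sum>i\<in>{0}. diam_power s (?U i))"
    by (rule suminf_finite) (auto simp: diam_power_def)
  finally show ?thesis by simp
qed

lemma hausdorff_premeasure_empty:
  "0 \<le> \<delta> \<Longrightarrow> hausdorff_premeasure s \<delta> {} = 0"
  using hausdorff_premeasure_le_diam_power[of "{}" \<delta> s] by (simp add: diam_power_def)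

lemma hausdorff_premeasure_countably_subadditive:
  fixes A :: "nat \<Rightarrow> 'a::metric_space set"
  shows "hausdorff_premeasure s \<delta> (\<Union>i. A i) \<le> (\<Sum>i. hausdorff_premeasure s \<delta> (A i))"
proof (rule ennreal_le_epsilon)
  fix e :: real
  assume fin: "(\<Sum>i. hausdorff_premeasure s \<delta> (A i)) < top" and e: "0 < e"
  have "\<exists>U :: nat \<Rightarrow> 'a set. A i \<subseteq> (\<Union>k. U k) \<and> (\<forall>k. bounded (U k) \<and> diameter (U k) \<le> \<delta>) \<and>
      (\<Sum>k. diam_power s (U k)) \<le> hausdorff_premeasure s \<delta> (A i) + ennreal (e * (1/2)^Suc i)" for i
  proof -
    have ltop: "hausdorff_premeasure s \<delta> (A i) < top"
      using ennreal_suminf_lessD[OF fin] by auto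
    have "hausdorff_premeasure s \<delta> (A i)
        < hausdorff_premeasure s \<delta> (A i) + ennreal (e * (1/2)^Suc i)"
      using ltop e by (simp add: ennreal_zero_less_mult_iff)
    then obtain U :: "nat \<Rightarrow> 'a set" where
      "A i \<subseteq> (\<Union>k. U k) \<and> (\<forall>k. bounded (U k) \<and> diameter (U k) \<le> \<delta>)"
      "(\<Sum>k. diam_power s (U k)) < hausdorff_premeasure s \<delta> (A i) + ennreal (e * (1/2)^Suc i)"
      by (subst (asm) hausdorff_premeasure_def) (auto simp only: INF_less_iff mem_Collect_eq)
    then show ?thesis by (intro exI[of _ U]) (auto intro: less_imp_le)
  qed
  then obtain U :: "nat \<Rightarrow> nat \<Rightarrow> 'a set" where U: "\<And>i. A i \<subseteq> (\<Union>k. U i k)"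
    "\<And>i k. bounded (U i k)" "\<And>i k. diameter (U i k) \<le> \<delta>"
    "\<And>i. (\<Sum>k. diam_power s (U i k)) \<le> hausdorff_premeasure s \<delta> (A i) + ennreal (e * (1/2)^Suc i)"
    by metis
  let ?V = "\<lambda>n. U (fst (prod_decode n)) (snd (prod_decode n))"
  have "hausdorff_premeasure s \<delta> (\<Union>i. A i) \<le> (\<Sum>n. diam_power s (?V n))"
  proof (rule hausdorff_premeasure_le_suminf)
    show "(\<Union>i. A i) \<subseteq> (\<Union>n. ?V n)"
    proof safe
      fix x i assume "x \<in> A i"
      then obtain k where "x \<in> U i k" using U(1) by blast
      then show "x \<in> (\<Union>n. ?V n)" by (auto intro!: exI[of _ "prod_encode (i, k)"])
    qed
  qed (use U in auto)
  also have "\<dots> = (\<Sum>i. \<Sum>k. diam_power s (U i k))"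
    using suminf_ennreal_2dimen[of "\<lambda>i. \<Sum>k. diam_power s (U i k)" "\<lambda>(i, k). diam_power s (U i k)"]
    by (simp add: case_prod_unfold comp_def)
  also have "\<dots> \<le> (\<Sum>i. hausdorff_premeasure s \<delta> (A i) + ennreal (e * (1/2)^Suc i))"
    by (intro suminf_le U) auto
  also have "\<dots> = (\<Sum>i. hausdorff_premeasure s \<delta> (A i)) + (\<Sum>i. ennreal (e * (1/2)^Suc i))"
    by (rule suminf_add[symmetric]) auto
  also have "(\<Sum>i. ennreal (e * (1/2)^Suc i)) = ennreal e"
  proof (rule suminf_ennreal_eq)
    show "(\<lambda>i. e * (1/2)^Suc i) sums e"
      using sums_mult[OF power_half_series, of e] by simp
  qed (use e in auto)
  finally show "hausdorff_premeasure s \<delta> (\<Union>i. A i) \<le> (\<Sum>i. hausdorff_premeasure s \<delta> (A i)) + ennreal e" .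
qed

lemma hausdorff_premeasure_subadditive:
  assumes "0 \<le> \<delta>"
  shows "hausdorff_premeasure s \<delta> (A \<union> B) \<le> hausdorff_premeasure s \<delta> A + hausdorff_premeasure s \<delta> B"
proof -
  have "hausdorff_premeasure s \<delta> (\<Union>i. binaryset A B i)
      \<le> (\<Sum>i. hausdorff_premeasure s \<delta> (binaryset A B i))"
    by (rule hausdorff_premeasure_countably_subadditive)
  also have "\<dots> = hausdorff_premeasure s \<delta> A + hausdorff_premeasure s \<delta> B"
    by (rule suminf_binaryset_eq) (simp add: hausdorff_premeasure_empty assms)
  finally show ?thesis by (simp add: UN_binaryset_eq)
qed

lemma hausdorff_premeasure_UN_pos:
  fixes X :: "'i::countable \<Rightarrow> 'a::metric_space set"
  assumes "0 < hausdorff_premeasure s \<delta> (\<Union>p. X p)"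
  obtains p where "0 < hausdorff_premeasure s \<delta> (X p)"
proof -
  have "(\<Union>p. X p) \<subseteq> (\<Union>n. X (from_nat n))"
    by (rule UN_least) (metis UN_upper UNIV_I from_nat_to_nat)
  then have "hausdorff_premeasure s \<delta> (\<Union>p. X p) \<le> hausdorff_premeasure s \<delta> (\<Union>n. X (from_nat n))"
    by (rule hausdorff_premeasure_mono)
  also have "\<dots> \<le> (\<Sum>n. hausdorff_premeasure s \<delta> (X (from_nat n)))"
    by (rule hausdorff_premeasure_countably_subadditive)
  finally have "0 < (\<Sum>n. hausdorff_premeasure s \<delta> (X (from_nat n)))"
    using assms by (rule less_le_trans[rotated])
  then have "\<exists>n. hausdorff_premeasure s \<delta> (X (from_nat n)) \<noteq> 0"
    by (rule contrapos_pp) simp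
  then show thesis using that by (auto simp: zero_less_iff_neq_zero)
qed

text \<open>The converse of the trivial comparison: if the content at scale \<open>\<delta>\<close> vanishes, then the covers that
witness this consist of arbitrarily small sets, because each single summand bounds a diameter, so
the premeasure vanishes at every scale. All further arguments can therefore
use the content at the single scale \<open>1\<close>.\<close>
lemma hausdorff_measure_pos_imp_premeasure_pos:
  assumes s: "0 < s" and \<delta>: "0 < \<delta>" and pos: "0 < hausdorff_measure s A"
  shows "0 < hausdorff_premeasure s \<delta> A"
proof (rule ccontr)
  assume "\<not> ?thesis"
  then have zero: "hausdorff_premeasure s \<delta> A = 0" by (simp add: zero_less_iff_neq_zero)
  have "hausdorff_premeasure s \<eta> A \<le> 0" if \<eta>: "0 < \<eta>" for \<eta>
  proof (rule ennreal_le_epsilon)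
    fix e :: real assume e: "0 < e"
    define e' where "e' = min e (\<eta> powr s)"
    have "0 < e'" using e \<eta> by (simp add: e'_def)
    then have "hausdorff_premeasure s \<delta> A < ennreal e'" using zero by simp
    then obtain U :: "nat \<Rightarrow> 'a set" where U: "A \<subseteq> (\<Union>i. U i)" "\<And>i. bounded (U i)"
      and sum: "(\<Sum>i. diam_power s (U i)) < ennreal e'"
      unfolding hausdorff_premeasure_def INF_less_iff by auto
    have "diameter (U i) \<le> \<eta>" for i
    proof (cases "U i = {}")
      case False
      have "ennreal (diameter (U i) powr s) = diam_power s (U i)"
        using s False by (simp add: diam_power_def)
      also have "\<dots> < ennreal e'" using ennreal_suminf_lessD[OF sum] .
      finally have "diameter (U i) powr s \<le> \<eta> powr s"
        by (auto simp: ennreal_less_iff e'_def)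
      then show ?thesis
        using s \<eta> diameter_ge_0[OF U(2), of i] powr_less_mono2[of s \<eta> "diameter (U i)"] by force
    qed (use \<eta> in simp)
    then have "hausdorff_premeasure s \<eta> A \<le> (\<Sum>i. diam_power s (U i))"
      by (intro hausdorff_premeasure_le_suminf U)
    also have "\<dots> \<le> ennreal e" using sum by (auto simp: e'_def ennreal_leI intro: order.trans less_imp_le)
    finally show "hausdorff_premeasure s \<eta> A \<le> 0 + ennreal e" by simp
  qed
  then have "hausdorff_measure s A \<le> 0"
    unfolding hausdorff_measure_def by (intro SUP_least) auto
  then show False using pos by simp
qed

section \<open>Finite Frostman weights on the line\<close>

definition dyadic :: "nat \<Rightarrow> int \<Rightarrow> real set" where
  "dyadic k j = {x. \<lfloor>2 ^ k * x\<rfloor> = j}"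

lemma dyadic_Suc: "dyadic k j = dyadic (Suc k) (2 * j) \<union> dyadic (Suc k) (2 * j + 1)"
proof (rule set_eqI)
  fix x :: real
  have "\<lfloor>2 ^ k * x\<rfloor> = \<lfloor>2 ^ Suc k * x / real_of_int 2\<rfloor>" by simp
  also have "\<dots> = \<lfloor>2 ^ Suc k * x\<rfloor> div 2" by (rule floor_divide_real_eq_div) simp
  finally have "\<lfloor>2 ^ k * x\<rfloor> = j \<longleftrightarrow> \<lfloor>2 ^ Suc k * x\<rfloor> = 2 * j \<or> \<lfloor>2 ^ Suc k * x\<rfloor> = 2 * j + 1"
    by linarith
  then show "x \<in> dyadic k j \<longleftrightarrow> x \<in> dyadic (Suc k) (2 * j) \<union> dyadic (Suc k) (2 * j + 1)"
    by (simp add: dyadic_def)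
qed

lemma dyadic_nested:
  assumes "k \<le> k'" "x \<in> dyadic k' j'" "y \<in> dyadic k' j'" "x \<in> dyadic k j"
  shows "y \<in> dyadic k j"
proof -
  have "\<lfloor>2 ^ k * z\<rfloor> = \<lfloor>2 ^ k' * z\<rfloor> div 2 ^ (k' - k)" for z :: real
  proof -
    have "2 ^ k' = (2 ^ k :: real) * 2 ^ (k' - k)"
      using \<open>k \<le> k'\<close> by (simp flip: power_add)
    then have "2 ^ k * z = 2 ^ k' * z / real_of_int (2 ^ (k' - k))" by simp
    then show ?thesis by (simp only: floor_divide_real_eq_div zero_le_power zero_le_numeral)
  qed
  then show ?thesis using assms by (simp add: dyadic_def)
qed

lemma dyadic_disjoint: "i \<noteq> j \<Longrightarrow> dyadic k i \<inter> dyadic k j = {}"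
  by (auto simp: dyadic_def)

lemma dyadic_dist_le:
  assumes "x \<in> dyadic k j" "y \<in> dyadic k j"
  shows "\<bar>x - y\<bar> \<le> (1/2) ^ k"
proof -
  have "\<bar>2 ^ k * x - 2 ^ k * y\<bar> \<le> 1"
    using assms unfolding dyadic_def by (simp, linarith)
  then have "2 ^ k * \<bar>x - y\<bar> \<le> 1" by (simp add: abs_mult flip: right_diff_distrib)
  then show ?thesis by (simp add: field_simps)
qed

lemma sum_Int_Un_disjoint:
  assumes "finite F\<^sub>0" "finite F\<^sub>1" "F\<^sub>0 \<inter> F\<^sub>1 = {}"
  shows "sum (\<lambda>x. if x \<in> F\<^sub>0 then f x else g x) ((F\<^sub>0 \<union> F\<^sub>1) \<inter> S) = sum f (F\<^sub>0 \<inter> S) + sum g (F\<^sub>1 \<inter> S)"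
proof -
  have "sum (\<lambda>x. if x \<in> F\<^sub>0 then f x else g x) ((F\<^sub>0 \<union> F\<^sub>1) \<inter> S)
      = sum (\<lambda>x. if x \<in> F\<^sub>0 then f x else g x) (F\<^sub>0 \<inter> S) + sum (\<lambda>x. if x \<in> F\<^sub>0 then f x else g x) (F\<^sub>1 \<inter> S)"
    unfolding Int_Un_distrib2 using assms by (intro sum.union_disjoint) auto
  also have "sum (\<lambda>x. if x \<in> F\<^sub>0 then f x else g x) (F\<^sub>0 \<inter> S) = sum f (F\<^sub>0 \<inter> S)"
    by (rule sum.cong) auto
  also have "sum (\<lambda>x. if x \<in> F\<^sub>0 then f x else g x) (F\<^sub>1 \<inter> S) = sum g (F\<^sub>1 \<inter> S)"
    using assms by (intro sum.cong) auto
  finally show ?thesis .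
qed

text \<open>The finite, maximal-flow form of Frostman's lemma, which makes sense for arbitrary sets. Start with
one atom of the largest admissible mass in each dyadic interval of length \<open>(1/2) ^ N\<close> that meets \<open>A\<close> and
climb up the dyadic tree. Whenever the two halves of an interval carry together more than
the interval may carry, rescale to the exact capacity. Subadditivity of \<open>h\<close> carries the lower mass bound from
the halves to the interval, and after a rescaling the capacity itself bounds \<open>h\<close>.
Taking \<open>h\<close> abstract allows the content of the image of a set of angles on the circle as well as
the content of a subset of the line.\<close>
lemma dyadic_frostman:
  fixes h :: "real set \<Rightarrow> ennreal" and A :: "real set" and s :: real
  assumes h_empty: "h {} = 0"
    and h_subadd: "\<And>B C. h (B \<union> C) \<le> h B + h C"
    and h_le: "\<And>k j. h (A \<inter> dyadic k j) \<le> ennreal (((1/2) ^ k) powr s)"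
    and "k \<le> N"
  shows "\<exists>F w. finite F \<and> F \<subseteq> A \<inter> dyadic k j \<and> (\<forall>x. 0 \<le> w x) \<and>
           h (A \<inter> dyadic k j) \<le> ennreal (sum w F) \<and>
           (\<forall>k' j'. k \<le> k' \<longrightarrow> k' \<le> N \<longrightarrow> sum w (F \<inter> dyadic k' j') \<le> ((1/2) ^ k') powr s)"
  using \<open>k \<le> N\<close>
proof (induction k arbitrary: j rule: inc_induct)
  case base
  show ?case
  proof (cases "A \<inter> dyadic N j = {}")
    case True
    then show ?thesis by (intro exI[of _ "{}"] exI[of _ "\<lambda>_. 0"]) (auto simp: h_empty)
  next
    case False
    then obtain a where a: "a \<in> A \<inter> dyadic N j" by auto
    show ?thesis
      using a h_le[of N j]
      by (intro exI[of _ "{a}"] exI[of _ "\<lambda>_. ((1/2) ^ N) powr s"])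
         (auto simp: Int_insert_left)
  qed
next
  case (step k)
  obtain F\<^sub>0 w\<^sub>0 where F\<^sub>0: "finite F\<^sub>0" "F\<^sub>0 \<subseteq> A \<inter> dyadic (Suc k) (2 * j)" "\<And>x. 0 \<le> w\<^sub>0 x"
    "h (A \<inter> dyadic (Suc k) (2 * j)) \<le> ennreal (sum w\<^sub>0 F\<^sub>0)"
    "\<And>k' j'. Suc k \<le> k' \<Longrightarrow> k' \<le> N \<Longrightarrow> sum w\<^sub>0 (F\<^sub>0 \<inter> dyadic k' j') \<le> ((1/2) ^ k') powr s"
    using step.IH by metis
  obtain F\<^sub>1 w\<^sub>1 where F\<^sub>1: "finite F\<^sub>1" "F\<^sub>1 \<subseteq> A \<inter> dyadic (Suc k) (2 * j + 1)" "\<And>x. 0 \<le> w\<^sub>1 x"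
    "h (A \<inter> dyadic (Suc k) (2 * j + 1)) \<le> ennreal (sum w\<^sub>1 F\<^sub>1)"
    "\<And>k' j'. Suc k \<le> k' \<Longrightarrow> k' \<le> N \<Longrightarrow> sum w\<^sub>1 (F\<^sub>1 \<inter> dyadic k' j') \<le> ((1/2) ^ k') powr s"
    using step.IH by metis
  have disj: "F\<^sub>0 \<inter> F\<^sub>1 = {}"
    using F\<^sub>0(2) F\<^sub>1(2) dyadic_disjoint[of "2 * j" "2 * j + 1" "Suc k"] by auto
  define w where "w x = (if x \<in> F\<^sub>0 then w\<^sub>0 x else w\<^sub>1 x)" for x
  define F where "F = F\<^sub>0 \<union> F\<^sub>1"
  define W where "W = sum w F"
  define q where "q = ((1/2) ^ k :: real) powr s"
  define c where "c = (if W \<le> q then 1 else q / W)"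
  have sum_w: "sum w (F \<inter> S) = sum w\<^sub>0 (F\<^sub>0 \<inter> S) + sum w\<^sub>1 (F\<^sub>1 \<inter> S)" for S
    unfolding w_def F_def by (intro sum_Int_Un_disjoint F\<^sub>0 F\<^sub>1 disj)
  have W: "W = sum w\<^sub>0 F\<^sub>0 + sum w\<^sub>1 F\<^sub>1" using sum_w[of UNIV] by (simp add: W_def)
  have w: "0 \<le> w x" for x using F\<^sub>0(3) F\<^sub>1(3) by (simp add: w_def)
  have "0 < q" by (simp add: q_def)
  have c: "0 \<le> c" "c \<le> 1" and cW: "c * W = min W q" using \<open>0 < q\<close> by (auto simp: c_def min_def)
  have F_sub: "F \<subseteq> A \<inter> dyadic k j" using F\<^sub>0(2) F\<^sub>1(2) by (auto simp: F_def dyadic_Suc[of k])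
  have "h (A \<inter> dyadic k j) \<le> ennreal W"
  proof -
    have "h (A \<inter> dyadic k j) \<le> h (A \<inter> dyadic (Suc k) (2 * j)) + h (A \<inter> dyadic (Suc k) (2 * j + 1))"
      using h_subadd by (simp add: dyadic_Suc[of k] Int_Un_distrib)
    also have "\<dots> \<le> ennreal (sum w\<^sub>0 F\<^sub>0) + ennreal (sum w\<^sub>1 F\<^sub>1)"
      by (intro add_mono F\<^sub>0 F\<^sub>1)
    finally show ?thesis using F\<^sub>0(3) F\<^sub>1(3) by (simp add: W ennreal_plus sum_nonneg)
  qed
  moreover have "h (A \<inter> dyadic k j) \<le> ennreal q" unfolding q_def by (rule h_le)
  ultimately have mass: "h (A \<inter> dyadic k j) \<le> ennreal (sum (\<lambda>x. c * w x) F)"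
    by (simp add: cW min_def flip: sum_distrib_left W_def)
  have "sum (\<lambda>x. c * w x) (F \<inter> dyadic k' j') \<le> ((1/2) ^ k') powr s" if k': "k \<le> k'" "k' \<le> N" for k' j'
  proof (cases "k' = k")
    case True
    have "sum (\<lambda>x. c * w x) (F \<inter> dyadic k' j') \<le> sum (\<lambda>x. c * w x) F"
      using F\<^sub>0(1) F\<^sub>1(1) c w by (intro sum_mono2) (auto simp: F_def)
    also have "\<dots> \<le> q" by (simp add: cW flip: sum_distrib_left W_def)
    finally show ?thesis using True by (simp add: q_def)
  next
    case False
    then have k'': "Suc k \<le> k'" using k' by simp
    have "F\<^sub>0 \<inter> dyadic k' j' = {} \<or> F\<^sub>1 \<inter> dyadic k' j' = {}"
    proof (rule ccontr)
      assume "\<not> ?thesis"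
      then obtain x y where x: "x \<in> F\<^sub>0" "x \<in> dyadic k' j'" and y: "y \<in> F\<^sub>1" "y \<in> dyadic k' j'" by auto
      then have "y \<in> dyadic (Suc k) (2 * j)" using F\<^sub>0(2) dyadic_nested[OF k''] by blast
      then show False using y F\<^sub>1(2) by (auto simp: dyadic_def)
    qed
    then have "sum w (F \<inter> dyadic k' j') \<le> ((1/2) ^ k') powr s"
      unfolding sum_w using F\<^sub>0(5)[OF k'' k'(2)] F\<^sub>1(5)[OF k'' k'(2)] by (metis add_0 add_0_right sum.empty)
    moreover have "c * sum w (F \<inter> dyadic k' j') \<le> 1 * sum w (F \<inter> dyadic k' j')"
      using c w by (intro mult_right_mono sum_nonneg)
    ultimately show ?thesis by (simp flip: sum_distrib_left)
  qed
  then show ?case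
    using F_sub mass c w F\<^sub>0(1) F\<^sub>1(1)
    by (intro exI[of _ F] exI[of _ "\<lambda>x. c * w x"]) (simp add: F_def)
qed

lemma ex_dyadic_scale:
  fixes r :: real
  assumes "(1/2) ^ N \<le> r" "r \<le> 2"
  obtains k where "k \<le> N" "(1/2) ^ k \<le> r" "r \<le> 2 * (1/2) ^ k"
proof -
  define k where "k = (LEAST k. (1/2) ^ k \<le> r)"
  have k: "(1/2) ^ k \<le> r" "k \<le> N"
    unfolding k_def using assms(1) by (auto intro: LeastI Least_le)
  have "r \<le> 2 * (1/2) ^ k"
  proof (cases k)
    case (Suc i)
    then have "\<not> (1/2) ^ i \<le> r" using not_less_Least[of i "\<lambda>k. (1/2) ^ k \<le> r"] by (simp add: k_def)
    then show ?thesis using Suc by simp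
  qed (use assms in simp)
  then show thesis using k that by blast
qed

text \<open>The weights come from a construction at resolution \<open>(1/2) ^ N\<close>, hence the lower limit on the radius. The constant is \<open>5\<close> because an interval of length \<open>2 * r\<close> meets at most five dyadic intervals of a
length between \<open>r / 2\<close> and \<open>r\<close>.\<close>
definition ball_growth :: "real \<Rightarrow> nat \<Rightarrow> real set \<Rightarrow> (real \<Rightarrow> real) \<Rightarrow> bool" where
  "ball_growth s N F w \<longleftrightarrow>
     (\<forall>y r. (1/2) ^ N \<le> r \<longrightarrow> sum w (F \<inter> {y - r..y + r}) \<le> 5 * r powr s)"

lemma ball_growth_of_dyadic:
  assumes "0 \<le> s" "finite F" "F \<subseteq> dyadic 0 j" "\<And>x. 0 \<le> w x"
    and growth: "\<And>k j. k \<le> N \<Longrightarrow> sum w (F \<inter> dyadic k j) \<le> ((1/2) ^ k) powr s"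
  shows "ball_growth s N F w"
  unfolding ball_growth_def
proof (intro allI impI)
  fix y r :: real assume r: "(1/2) ^ N \<le> r"
  have "0 < r" using r by (rule less_le_trans[rotated]) simp
  show "sum w (F \<inter> {y - r..y + r}) \<le> 5 * r powr s"
  proof (cases "r \<le> 2")
    case False
    have "sum w (F \<inter> {y - r..y + r}) \<le> sum w (F \<inter> dyadic 0 j)"
      using assms by (intro sum_mono2) auto
    also have "\<dots> \<le> 1" using growth[of 0 j] by simp
    also have "\<dots> \<le> r powr s" using False \<open>0 \<le> s\<close> by (intro ge_one_powr_ge_zero) auto
    also have "\<dots> \<le> 5 * r powr s" by simp
    finally show ?thesis .
  next
    case True
    then obtain k where k: "k \<le> N" "(1/2) ^ k \<le> r" "r \<le> 2 * (1/2) ^ k"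
      using ex_dyadic_scale r by blast
    define J where "J = {\<lfloor>2 ^ k * (y - r)\<rfloor>..\<lfloor>2 ^ k * (y - r)\<rfloor> + 4}"
    have "(\<lambda>x. \<lfloor>2 ^ k * x\<rfloor>) ` (F \<inter> {y - r..y + r}) \<subseteq> J"
    proof safe
      fix x assume x: "x \<in> {y - r..y + r}"
      have "2 ^ k * (2 * r) \<le> 2 ^ k * (4 * (1/2) ^ k)" using k by (intro mult_left_mono) auto
      also have "\<dots> = 4" by (simp add: field_simps)
      finally have "2 ^ k * (y + r) \<le> 2 ^ k * (y - r) + 4" by (simp add: algebra_simps)
      moreover have "2 ^ k * x \<le> 2 ^ k * (y + r)" "2 ^ k * (y - r) \<le> 2 ^ k * x" using x by auto
      ultimately show "\<lfloor>2 ^ k * x\<rfloor> \<in> J" unfolding J_def atLeastAtMost_iff by linarith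
    qed
    then have "sum w (F \<inter> {y - r..y + r})
        = (\<Sum>i\<in>J. sum w {x \<in> F \<inter> {y - r..y + r}. \<lfloor>2 ^ k * x\<rfloor> = i})"
      using \<open>finite F\<close> by (subst sum.group) (auto simp: J_def)
    also have "\<dots> \<le> (\<Sum>i\<in>J. sum w (F \<inter> dyadic k i))"
      using assms by (intro sum_mono sum_mono2) (auto simp: dyadic_def)
    also have "\<dots> \<le> (\<Sum>i\<in>J. r powr s)"
    proof (intro sum_mono)
      fix i
      have "sum w (F \<inter> dyadic k i) \<le> ((1/2) ^ k) powr s" using growth k by blast
      also have "\<dots> \<le> r powr s" using k \<open>0 \<le> s\<close> by (intro powr_mono2) auto
      finally show "sum w (F \<inter> dyadic k i) \<le> r powr s" .
    qed
    also have "\<dots> = 5 * r powr s" by (simp add: J_def)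
    finally show ?thesis .
  qed
qed

lemma frostman:
  fixes h :: "real set \<Rightarrow> ennreal" and A :: "real set" and s :: real
  assumes "h {} = 0" "\<And>B C. h (B \<union> C) \<le> h B + h C"
    and "\<And>k j. h (A \<inter> dyadic k j) \<le> ennreal (((1/2) ^ k) powr s)"
    and "0 \<le> s" "A \<subseteq> dyadic 0 j"
  obtains F w where "finite F" "F \<subseteq> A" "\<And>x. 0 \<le> w x" "h A \<le> ennreal (sum w F)" "ball_growth s N F w"
proof -
  obtain F w where F: "finite F" "F \<subseteq> A \<inter> dyadic 0 j" "\<And>x. 0 \<le> w x"
    "h (A \<inter> dyadic 0 j) \<le> ennreal (sum w F)"
    "\<And>k j. 0 \<le> k \<Longrightarrow> k \<le> N \<Longrightarrow> sum w (F \<inter> dyadic k j) \<le> ((1/2) ^ k) powr s"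
    using dyadic_frostman[where h = h and A = A and s = s and N = N and k = 0 and j = j, OF assms(1-3) le0] by blast
  have "ball_growth s N F w"
    using F \<open>0 \<le> s\<close> by (intro ball_growth_of_dyadic[of s F j]) auto
  then show thesis using F assms(5) by (intro that[of F w]) (auto simp: Int_absorb2)
qed

text \<open>Weights with growth exponent \<open>u\<close> have bounded potentials of every order \<open>v < u\<close>, uniformly in the
resolution: the dyadic shell of radius about \<open>(1/2) ^ k\<close> contributes at most a multiple of
\<open>(1/2) powr (k * (u - v))\<close>, and the shells sum to a geometric series.\<close>
lemma potential_le:
  fixes u v \<theta> :: real
  assumes "0 \<le> v" "v < u" and F: "finite F" "\<And>x. 0 \<le> w x" "ball_growth u N F w"
    and near: "\<And>x. x \<in> F \<Longrightarrow> \<bar>\<theta> - x\<bar> \<le> 1"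
  shows "(\<Sum>x\<in>F. w x * (\<bar>\<theta> - x\<bar> + (1/2) ^ N) powr (- v)) \<le> 5 * 2 powr u / (1 - (1/2) powr (u - v))"
proof -
  define I where "I k = F \<inter> {\<theta> - 2 * (1/2) ^ k..\<theta> + 2 * (1/2) ^ k}" for k :: nat
  have half: "((1/2) ^ k) powr t = ((1/2) powr t) ^ k" for k and t :: real
    by (simp add: powr_powr mult.commute flip: powr_realpow)
  have ratio: "(1/2) powr (u - v) < 1"
    using \<open>v < u\<close> powr_less_mono[of 0 "u - v" "2::real"] by (simp add: powr_divide)
  have *: "(\<bar>\<theta> - x\<bar> + (1/2) ^ N) powr (- v) \<le> (\<Sum>k\<le>N. if x \<in> I k then ((1/2) ^ k) powr (- v) else 0)"
    if x: "x \<in> F" for x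
  proof -
    define r where "r = \<bar>\<theta> - x\<bar> + (1/2) ^ N"
    have "(1/2) ^ N \<le> r" "r \<le> 2"
      using near[OF x] power_le_one[of "1/2::real" N] by (auto simp: r_def)
    then obtain k where k: "k \<le> N" "(1/2) ^ k \<le> r" "r \<le> 2 * (1/2) ^ k"
      using ex_dyadic_scale by blast
    have "\<bar>\<theta> - x\<bar> \<le> r" by (simp add: r_def)
    then have "x \<in> I k" using k x unfolding I_def by auto
    have "r powr (- v) \<le> ((1/2) ^ k) powr (- v)"
      using k \<open>0 \<le> v\<close> by (intro powr_mono2') auto
    also have "\<dots> = (\<Sum>k\<in>{k}. if x \<in> I k then ((1/2) ^ k) powr (- v) else 0)"
      using \<open>x \<in> I k\<close> by simp
    also have "\<dots> \<le> (\<Sum>k\<le>N. if x \<in> I k then ((1/2) ^ k) powr (- v) else 0)"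
      using k by (intro sum_mono2) auto
    finally show ?thesis by (simp add: r_def)
  qed
  have "(\<Sum>x\<in>F. w x * (\<bar>\<theta> - x\<bar> + (1/2) ^ N) powr (- v))
      \<le> (\<Sum>x\<in>F. w x * (\<Sum>k\<le>N. if x \<in> I k then ((1/2) ^ k) powr (- v) else 0))"
    using * F(2) by (intro sum_mono mult_left_mono) auto
  also have "\<dots> = (\<Sum>k\<le>N. \<Sum>x\<in>F. if x \<in> I k then w x * ((1/2) ^ k) powr (- v) else 0)"
    by (simp add: sum_distrib_left if_distrib sum.swap[of _ F] cong: if_cong)
  also have "\<dots> = (\<Sum>k\<le>N. sum w (I k) * ((1/2) ^ k) powr (- v))"
    by (intro sum.cong refl)
       (simp add: sum.If_cases[OF F(1)] sum_distrib_right I_def Int_def conj_ac cong: conj_cong)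
  also have "\<dots> \<le> (\<Sum>k\<le>N. 5 * 2 powr u * ((1/2) powr (u - v)) ^ k)"
  proof (intro sum_mono)
    fix k assume k: "k \<in> {..N}"
    have "(1/2::real) ^ N \<le> (1/2) ^ k" using k by (intro power_decreasing) auto
    also have "\<dots> \<le> 2 * (1/2) ^ k" by simp
    finally have "sum w (I k) \<le> 5 * (2 * (1/2) ^ k) powr u"
      using F(3) unfolding ball_growth_def I_def by blast
    then have "sum w (I k) * ((1/2) ^ k) powr (- v)
        \<le> 5 * (2 * (1/2) ^ k) powr u * ((1/2) ^ k) powr (- v)"
      by (rule mult_right_mono) simp
    also have "\<dots> = 5 * 2 powr u * ((1/2) ^ k) powr (u - v)"
      by (simp add: powr_mult powr_diff powr_minus_divide)
    finally show "sum w (I k) * ((1/2) ^ k) powr (- v) \<le> 5 * 2 powr u * ((1/2) powr (u - v)) ^ k"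
      by (simp add: half)
  qed
  also have "\<dots> \<le> (\<Sum>k. 5 * 2 powr u * ((1/2) powr (u - v)) ^ k)"
    using ratio by (intro sum_le_suminf summable_mult summable_geometric) auto
  also have "\<dots> = 5 * 2 powr u * (1 / (1 - (1/2) powr (u - v)))"
    using ratio by (subst suminf_mult) (auto simp: suminf_geometric intro!: summable_geometric)
  finally show ?thesis by simp
qed

section \<open>Union and overlap of weighted families\<close>

text \<open>The Cauchy--Schwarz inequality for \<open>f = (\<Sum>i\<in>I. w i * indicator (R i))\<close>: its integral is at least
\<open>a * sum w I\<close>, its squared \<open>L\<^sup>2\<close> norm is at most \<open>b * sum w I\<close>, and it lives on \<open>U\<close>. Hence a family with
little overlap forces its union to be large.\<close>
lemma weighted_overlap_bound:
  fixes w :: "'i \<Rightarrow> real" and R :: "'i \<Rightarrow> 'a set"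
  assumes I: "finite I" "\<And>i. i \<in> I \<Longrightarrow> 0 \<le> w i"
    and R: "\<And>i. i \<in> I \<Longrightarrow> R i \<in> fmeasurable M" "\<And>i. i \<in> I \<Longrightarrow> R i \<subseteq> U"
    and U: "U \<in> fmeasurable M"
    and "0 < a" "0 < b"
    and large: "\<And>i. i \<in> I \<Longrightarrow> a \<le> measure M (R i)"
    and overlap: "\<And>i. i \<in> I \<Longrightarrow> (\<Sum>j\<in>I. w j * measure M (R i \<inter> R j)) \<le> b"
  shows "sum w I * a\<^sup>2 \<le> b * measure M U"
proof -
  define l where "l = b / a"
  have l: "0 < l" using \<open>0 < a\<close> \<open>0 < b\<close> by (simp add: l_def)
  let ?f = "\<lambda>x. \<Sum>i\<in>I. w i * indicat_real (R i) x"
  let ?g = "\<lambda>x. (\<Sum>i\<in>I. \<Sum>j\<in>I. w i * w j * indicat_real (R i \<inter> R j) x)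
      - 2 * l * ?f x + l\<^sup>2 * indicat_real U x"
  have int_ind: "integrable M (indicat_real A)" "integral\<^sup>L M (indicat_real A) = measure M A"
    if "A \<in> fmeasurable M" for A
    using that by (auto simp: fmeasurable_def sets.sets_into_space Int_absorb2 Int_commute)
  have RR: "R i \<inter> R j \<in> fmeasurable M" if "i \<in> I" "j \<in> I" for i j
    using R that by (intro fmeasurable_Int_fmeasurable) (auto simp: fmeasurable_def)
  \<comment> \<open>Cauchy--Schwarz is obtained by integrating the square of
    \<open>f - l * indicator U\<close> with \<open>l = b / a\<close>.\<close>
  have "?g x = (?f x - l * indicat_real U x)\<^sup>2" for x
  proof -
    have *: "?f x * indicat_real U x = ?f x"
      using R(2) by (cases "x \<in> U") (force simp: indicator_def intro!: sum.neutral)+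
    have "(\<Sum>i\<in>I. \<Sum>j\<in>I. w i * w j * indicat_real (R i \<inter> R j) x) = ?f x * ?f x"
      by (simp add: sum_product indicator_inter_arith mult_ac)
    moreover have "indicat_real U x * indicat_real U x = indicat_real U x" by (simp add: indicator_def)
    moreover have "F * F - 2 * l * F + l\<^sup>2 * i = (F - l * i)\<^sup>2" if "F * i = F" "i * i = i" for F i :: real
    proof -
      have "(F - l * i)\<^sup>2 = F * F - 2 * l * (F * i) + l\<^sup>2 * (i * i)"
        by (simp add: power2_eq_square algebra_simps)
      then show ?thesis using that by simp
    qed
    ultimately show ?thesis using * by simp
  qed
  then have "0 \<le> integral\<^sup>L M ?g" by (intro Bochner_Integration.integral_nonneg) simp
  also have "integral\<^sup>L M ?g = (\<Sum>i\<in>I. \<Sum>j\<in>I. w i * w j * measure M (R i \<inter> R j))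
      - 2 * l * (\<Sum>i\<in>I. w i * measure M (R i)) + l\<^sup>2 * measure M U"
    using int_ind R(1) RR U by simp
  finally have "2 * l * (\<Sum>i\<in>I. w i * measure M (R i))
      \<le> (\<Sum>i\<in>I. w i * (\<Sum>j\<in>I. w j * measure M (R i \<inter> R j))) + l\<^sup>2 * measure M U"
    by (simp add: sum_distrib_left mult.assoc)
  moreover have "(\<Sum>i\<in>I. w i * (\<Sum>j\<in>I. w j * measure M (R i \<inter> R j))) \<le> (\<Sum>i\<in>I. w i * b)"
    using I overlap by (intro sum_mono mult_left_mono) auto
  moreover have "2 * l * (\<Sum>i\<in>I. w i * a) \<le> 2 * l * (\<Sum>i\<in>I. w i * measure M (R i))"
    using I large l by (intro mult_left_mono sum_mono) auto
  ultimately have "2 * l * (sum w I * a) \<le> sum w I * b + l\<^sup>2 * measure M U"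
    by (simp add: sum_distrib_right)
  moreover have "2 * l * (sum w I * a) = 2 * (sum w I * b)" using \<open>0 < a\<close> by (simp add: l_def)
  ultimately have "2 * (sum w I * b) \<le> sum w I * b + l\<^sup>2 * measure M U" by (simp only:)
  then have "sum w I * b \<le> (b / a)\<^sup>2 * measure M U" by (simp add: l_def mult.commute)
  then have "b * (sum w I * a\<^sup>2) \<le> b * (b * measure M U)"
    using \<open>0 < a\<close> by (simp add: field_simps power2_eq_square)
  then show ?thesis using \<open>0 < b\<close> by simp
qed

section \<open>Rectangles around segments\<close>

lemma measure_parallelogram:
  fixes p q :: "real^2"
  assumes D: "p$1 * q$2 - p$2 * q$1 \<noteq> 0" and "a \<le> b" "c \<le> d"
  defines "S \<equiv> {x. a \<le> x \<bullet> p \<and> x \<bullet> p \<le> b \<and> c \<le> x \<bullet> q \<and> x \<bullet> q \<le> d}"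
  shows "S \<in> lmeasurable"
    and "measure lebesgue S = (b - a) * (d - c) / \<bar>p$1 * q$2 - p$2 * q$1\<bar>"
proof -
  define D where "D = p$1 * q$2 - p$2 * q$1"
  define g :: "real^2 \<Rightarrow> real^2"
    where "g y = vector [(q$2 * y$1 - p$2 * y$2) / D, (p$1 * y$2 - q$1 * y$1) / D]" for y
  let ?B = "cbox (vector [a, c]) (vector [b, d]) :: (real^2) set"
  have lin: "linear g"
    unfolding g_def by (rule linearI) (simp_all add: vec_eq_iff forall_2 algebra_simps add_divide_distrib diff_divide_distrib)
  have D0: "D \<noteq> 0" using assms(1) by (simp add: D_def)
  have gp: "g y \<bullet> p = y$1" "g y \<bullet> q = y$2" for y
    using D0 by (simp_all add: g_def inner_vec_def sum_2 field_simps) (simp_all add: D_def algebra_simps)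
  have gx: "g (vector [x \<bullet> p, x \<bullet> q]) = x" for x
    using D0 by (simp add: g_def vec_eq_iff forall_2 inner_vec_def sum_2 field_simps) (simp add: D_def algebra_simps)
  have S: "S = g ` ?B"
  proof
    show "S \<subseteq> g ` ?B"
    proof
      fix x assume "x \<in> S"
      then have "vector [x \<bullet> p, x \<bullet> q] \<in> ?B" by (simp add: S_def mem_box_cart forall_2)
      then show "x \<in> g ` ?B" using gx[of x] by force
    qed
    show "g ` ?B \<subseteq> S" by (auto simp: S_def gp mem_box_cart forall_2)
  qed
  show "S \<in> lmeasurable" unfolding S by (rule measurable_linear_image[OF lin]) simp
  have "det (matrix g) = (q$2 * p$1 - p$2 * q$1) / D\<^sup>2"
    by (simp add: matrix_def det_2 g_def axis_def power2_eq_square diff_divide_distrib mult.commute)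
  then have det: "\<bar>det (matrix g)\<bar> = 1 / \<bar>D\<bar>"
  proof -
    have "q$2 * p$1 - p$2 * q$1 = D" by (simp add: D_def mult.commute)
    moreover have "\<bar>D\<bar> / (D * D) = 1 / \<bar>D\<bar>" using D0 by (cases "0 \<le> D") auto
    ultimately show ?thesis using \<open>det (matrix g) = _\<close> by (simp add: power2_eq_square abs_mult)
  qed
  have "measure lebesgue ?B = (b - a) * (d - c)"
    using assms(2,3) by (subst measure_completion) (auto simp: content_cbox_cart interval_ne_empty_cart UNIV_2 forall_2)
  then show "measure lebesgue S = (b - a) * (d - c) / \<bar>p$1 * q$2 - p$2 * q$1\<bar>"
    unfolding S by (subst measure_linear_image[OF lin]) (auto simp: det D_def)
qed

definition dir :: "real \<Rightarrow> real^2" where "dir \<theta> = vector [cos \<theta>, sin \<theta>]"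

definition dir_perp :: "real \<Rightarrow> real^2" where "dir_perp \<theta> = vector [- sin \<theta>, cos \<theta>]"

definition rectangle :: "real \<Rightarrow> real \<Rightarrow> real \<Rightarrow> real \<Rightarrow> real \<Rightarrow> (real^2) set" where
  "rectangle \<delta> \<theta> t \<alpha> \<beta> =
     {x. t - \<delta> \<le> x \<bullet> dir \<theta> \<and> x \<bullet> dir \<theta> \<le> t + \<delta> \<and> \<alpha> \<le> x \<bullet> dir_perp \<theta> \<and> x \<bullet> dir_perp \<theta> \<le> \<beta>}"

lemma dir_decomposition: "x = (x \<bullet> dir \<theta>) *\<^sub>R dir \<theta> + (x \<bullet> dir_perp \<theta>) *\<^sub>R dir_perp \<theta>"
proof -
  have "x$1 = (x$1 * c + x$2 * s) * c - (x$2 * c - x$1 * s) * s"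
    "x$2 = (x$1 * c + x$2 * s) * s + (x$2 * c - x$1 * s) * c" if "s\<^sup>2 + c\<^sup>2 = 1" for s c
    using that by algebra+
  from this[OF sin_cos_squared_add] show ?thesis
    by (simp add: vec_eq_iff forall_2 dir_def dir_perp_def inner_vec_def sum_2 algebra_simps)
qed

lemma norm_dir [simp]: "norm (dir \<theta>) = 1" "norm (dir_perp \<theta>) = 1"
  by (simp_all add: norm_eq_1 dir_def dir_perp_def inner_vec_def sum_2
      sin_cos_squared_add[unfolded power2_eq_square] sin_cos_squared_add3)

lemma inner_dir [simp]:
  "dir \<theta> \<bullet> dir \<theta> = 1" "dir_perp \<theta> \<bullet> dir_perp \<theta> = 1"
  "dir \<theta> \<bullet> dir_perp \<theta> = 0" "dir_perp \<theta> \<bullet> dir \<theta> = 0"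
  using norm_dir[of \<theta>] by (simp_all add: norm_eq_1) (simp_all add: dir_def dir_perp_def inner_vec_def sum_2
      sin_cos_squared_add[unfolded power2_eq_square] sin_cos_squared_add3)

lemma sphere_eq_range_dir: "sphere 0 1 = range dir"
proof
  show "sphere 0 1 \<subseteq> range dir"
  proof
    fix e :: "real^2" assume "e \<in> sphere 0 1"
    then have "(e$1)\<^sup>2 + (e$2)\<^sup>2 = 1"
      by (simp add: norm_eq_1 inner_vec_def sum_2 power2_eq_square)
    then obtain \<theta> where "e$1 = cos \<theta>" "e$2 = sin \<theta>" using sincos_total_2pi by metis
    then have "e = dir \<theta>" by (simp add: dir_def vec_eq_iff forall_2)
    then show "e \<in> range dir" by simp
  qed
qed auto

text \<open>A chord is no longer than its arc. So \<open>dir\<close> transfers covers of a set of angles to covers of the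
set of directions.\<close>
lemma norm_dir_diff_le: "norm (dir x - dir y) \<le> \<bar>x - y\<bar>"
proof -
  obtain z where z: "x - y = 2 * z" by (rule that[of "(x - y) / 2"]) simp
  have "(norm (dir x - dir y))\<^sup>2 = (cos x - cos y)\<^sup>2 + (sin x - sin y)\<^sup>2"
    by (simp add: power2_norm_eq_inner inner_vec_def sum_2 dir_def flip: power2_eq_square)
  also have "\<dots> = 2 - 2 * cos (x - y)"
    using sin_cos_squared_add[of x] sin_cos_squared_add[of y]
    by (simp add: cos_diff power2_eq_square algebra_simps)
  also have "\<dots> = (2 * sin z)\<^sup>2" by (simp add: z cos_double_sin power_mult_distrib)
  also have "\<dots> \<le> (x - y)\<^sup>2"
    using abs_sin_x_le_abs_x[of z] by (subst abs_le_square_iff[symmetric]) (simp add: z abs_mult)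
  finally show ?thesis using abs_le_square_iff[of "norm (dir x - dir y)" "x - y"] by simp
qed

lemma abs_sin_ge_half:
  fixes x :: real
  assumes "\<bar>x\<bar> \<le> 1"
  shows "\<bar>x\<bar> / 2 \<le> \<bar>sin x\<bar>"
proof -
  have *: "y / 2 \<le> sin y" if y: "0 \<le> y" "y \<le> 1" for y :: real
  proof -
    have "sin 0 - 0 / 2 \<le> sin y - y / 2"
    proof (rule DERIV_nonneg_imp_nondecreasing[OF y(1)])
      fix z :: real assume z: "0 \<le> z" "z \<le> y"
      have "\<bar>sin (z / 2)\<bar> \<le> 1 / 2" using abs_sin_x_le_abs_x[of "z / 2"] z y by simp
      then have "(sin (z / 2))\<^sup>2 \<le> (1 / 2)\<^sup>2" by (subst abs_le_square_iff[symmetric]) simp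
      then have "0 \<le> cos z - 1 / 2"
        using cos_double_sin[of "z / 2"] by (simp add: power2_eq_square)
      moreover have "((\<lambda>y. sin y - y / 2) has_real_derivative cos z - 1 / 2) (at z)"
        by (auto intro!: derivative_eq_intros)
      ultimately show "\<exists>d. ((\<lambda>y. sin y - y / 2) has_real_derivative d) (at z) \<and> 0 \<le> d" by blast
    qed
    then show ?thesis by simp
  qed
  show ?thesis
    using *[of x] *[of "- x"] assms by (cases "0 \<le> x") (auto simp: abs_if split: if_splits)
qed

lemma dir_perp_det: "dir \<theta> $ 1 * dir_perp \<theta> $ 2 - dir \<theta> $ 2 * dir_perp \<theta> $ 1 = 1"
  by (simp add: dir_def dir_perp_def flip: power2_eq_square)

lemma rectangle_measure:
  assumes "0 \<le> \<delta>" "\<alpha> \<le> \<beta>"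
  shows "rectangle \<delta> \<theta> t \<alpha> \<beta> \<in> lmeasurable"
    and "measure lebesgue (rectangle \<delta> \<theta> t \<alpha> \<beta>) = 2 * \<delta> * (\<beta> - \<alpha>)"
  using measure_parallelogram[of "dir \<theta>" "dir_perp \<theta>" "t - \<delta>" "t + \<delta>" \<alpha> \<beta>] assms
  by (simp_all add: dir_perp_det rectangle_def)

lemma rectangle_subset_thickening:
  assumes "\<And>y. y \<in> {\<alpha>..\<beta>} \<Longrightarrow> t *\<^sub>R dir \<theta> + y *\<^sub>R dir_perp \<theta> \<in> K"
  shows "rectangle \<delta> \<theta> t \<alpha> \<beta> \<subseteq> (\<Union>x\<in>K. cball x \<delta>)"
proof
  fix x assume x: "x \<in> rectangle \<delta> \<theta> t \<alpha> \<beta>"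
  define a b where "a = x \<bullet> dir \<theta>" and "b = x \<bullet> dir_perp \<theta>"
  define z where "z = t *\<^sub>R dir \<theta> + b *\<^sub>R dir_perp \<theta>"
  have "x = a *\<^sub>R dir \<theta> + b *\<^sub>R dir_perp \<theta>"
    unfolding a_def b_def by (rule dir_decomposition)
  then have "z - x = (t - a) *\<^sub>R dir \<theta>" by (simp add: z_def scaleR_left_diff_distrib)
  then have "dist z x \<le> \<delta>" using x by (simp add: dist_norm rectangle_def a_def abs_le_iff)
  moreover have "z \<in> K" using x assms by (simp add: z_def b_def rectangle_def)
  ultimately show "x \<in> (\<Union>x\<in>K. cball x \<delta>)" by auto
qed

text \<open>Two strips of half-width \<open>\<delta>\<close> meet in a parallelogram of area \<open>4 * \<delta>\<^sup>2 / \<bar>sin (\<theta> - \<theta>')\<bar>\<close>. As the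
angle is at most one, the sine is comparable to it, and this bound is used while the angle is at least
\<open>\<delta>\<close>; below that the area of one rectangle is used. In both cases the bound is a multiple of \<open>\<delta>\<^sup>2 / r\<close>. Moreover, inside a disc of radius \<open>\<rho>\<close>
the functional \<open>x \<bullet> dir \<theta>\<close> changes by at most \<open>\<rho> * \<bar>\<theta> - \<theta>'\<bar>\<close> with the angle, so strips with nearby
directions can meet only if their offsets \<open>t\<close>, \<open>t'\<close> are close. This second part is what lets the
dimension of the families of segments enter.\<close>
lemma rectangle_overlap:
  assumes \<delta>: "0 < \<delta>" "\<delta> \<le> 1" and "\<alpha> \<le> \<beta>" "\<alpha>' \<le> \<beta>'" and close: "\<bar>\<theta> - \<theta>'\<bar> \<le> 1"
    and in_disc: "rectangle \<delta> \<theta> t \<alpha> \<beta> \<subseteq> cball 0 \<rho>" and "0 \<le> \<rho>"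
  defines "r \<equiv> \<bar>\<theta> - \<theta>'\<bar> + \<delta>"
  shows "measure lebesgue (rectangle \<delta> \<theta> t \<alpha> \<beta> \<inter> rectangle \<delta> \<theta>' t' \<alpha>' \<beta>') \<le> (16 + 8 * \<rho>) * \<delta>\<^sup>2 / r"
    and "rectangle \<delta> \<theta> t \<alpha> \<beta> \<inter> rectangle \<delta> \<theta>' t' \<alpha>' \<beta>' \<noteq> {} \<Longrightarrow> \<bar>t - t'\<bar> \<le> (\<rho> + 2) * r"
proof -
  let ?R = "rectangle \<delta> \<theta> t \<alpha> \<beta>" and ?R' = "rectangle \<delta> \<theta>' t' \<alpha>' \<beta>'"
  have r: "0 < r" using \<delta> by (simp add: r_def)
  have lm: "?R \<in> lmeasurable" "?R' \<in> lmeasurable" using rectangle_measure assms by simp_all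
  show "measure lebesgue (?R \<inter> ?R') \<le> (16 + 8 * \<rho>) * \<delta>\<^sup>2 / r"
  proof (cases "\<delta> \<le> \<bar>\<theta> - \<theta>'\<bar>")
    case True
    let ?P = "{x. t - \<delta> \<le> x \<bullet> dir \<theta> \<and> x \<bullet> dir \<theta> \<le> t + \<delta> \<and> t' - \<delta> \<le> x \<bullet> dir \<theta>' \<and> x \<bullet> dir \<theta>' \<le> t' + \<delta>}"
    define D where "D = dir \<theta> $ 1 * dir \<theta>' $ 2 - dir \<theta> $ 2 * dir \<theta>' $ 1"
    have "D = sin (\<theta>' - \<theta>)" by (simp add: D_def dir_def sin_diff mult.commute)
    then have "\<bar>\<theta> - \<theta>'\<bar> / 2 \<le> \<bar>D\<bar>" 
      using abs_sin_ge_half[of "\<theta>' - \<theta>"] close by (simp add: abs_minus_commute[of \<theta> \<theta>'])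
    then have D: "r / 4 \<le> \<bar>D\<bar>" using True by (simp add: r_def)
    then have D0: "D \<noteq> 0" using r by auto
    have P: "?P \<in> lmeasurable" "measure lebesgue ?P = (2 * \<delta>) * (2 * \<delta>) / \<bar>D\<bar>"
      using measure_parallelogram[of "dir \<theta>" "dir \<theta>'" "t - \<delta>" "t + \<delta>" "t' - \<delta>" "t' + \<delta>"] \<delta> D0
      by (simp_all add: D_def)
    have "measure lebesgue (?R \<inter> ?R') \<le> measure lebesgue ?P"
      using P lm by (intro measure_mono_fmeasurable) (auto simp: rectangle_def)
    also have "\<dots> \<le> (2 * \<delta>) * (2 * \<delta>) / (r / 4)"
      unfolding P using D r D0 by (intro divide_left_mono) auto
    also have "\<dots> = 16 * \<delta>\<^sup>2 / r" by (simp add: power2_eq_square)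
    also have "\<dots> \<le> (16 + 8 * \<rho>) * \<delta>\<^sup>2 / r"
      using r \<open>0 \<le> \<rho>\<close> by (intro divide_right_mono mult_right_mono) auto
    finally show ?thesis .
  next
    case False
    have *: "\<bar>y\<bar> \<le> \<rho>" if "y = \<alpha> \<or> y = \<beta>" for y
    proof -
      define z where "z = t *\<^sub>R dir \<theta> + y *\<^sub>R dir_perp \<theta>"
      have "z \<in> ?R" using that \<delta> \<open>\<alpha> \<le> \<beta>\<close> by (auto simp: z_def rectangle_def inner_left_distrib)
      then have "norm z \<le> \<rho>" using in_disc by auto
      moreover have "\<bar>z \<bullet> dir_perp \<theta>\<bar> \<le> norm z" using Cauchy_Schwarz_ineq2[of z "dir_perp \<theta>"] by simp
      ultimately show ?thesis by (simp add: z_def inner_left_distrib)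
    qed
    have "measure lebesgue (?R \<inter> ?R') \<le> measure lebesgue ?R"
      using lm by (intro measure_mono_fmeasurable) auto
    also have "\<dots> = 2 * \<delta> * (\<beta> - \<alpha>)" using rectangle_measure \<delta> \<open>\<alpha> \<le> \<beta>\<close> by simp
    also have "\<dots> \<le> 2 * \<delta> * (2 * \<rho>)" using *[of \<alpha>] *[of \<beta>] \<delta> by (intro mult_left_mono) auto
    also have "\<dots> \<le> (16 + 8 * \<rho>) * \<delta>\<^sup>2 / r"
    proof -
      have "2 * \<delta> * (2 * \<rho>) * r \<le> 2 * \<delta> * (2 * \<rho>) * (2 * \<delta>)"
        using False \<delta> \<open>0 \<le> \<rho>\<close> by (intro mult_left_mono) (auto simp: r_def)
      also have "\<dots> \<le> (16 + 8 * \<rho>) * \<delta>\<^sup>2" by (simp add: power2_eq_square algebra_simps)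
      finally show ?thesis using r by (simp add: field_simps)
    qed
    finally show ?thesis .
  qed
  assume "?R \<inter> ?R' \<noteq> {}"
  then obtain x where x: "x \<in> ?R" "x \<in> ?R'" by auto
  have "\<bar>x \<bullet> dir \<theta> - x \<bullet> dir \<theta>'\<bar> \<le> norm x * norm (dir \<theta> - dir \<theta>')"
    using Cauchy_Schwarz_ineq2[of x "dir \<theta> - dir \<theta>'"] by (simp add: inner_diff_right)
  also have "\<dots> \<le> \<rho> * \<bar>\<theta> - \<theta>'\<bar>"
    using x(1) in_disc norm_dir_diff_le[of \<theta> \<theta>'] \<open>0 \<le> \<rho>\<close> by (intro mult_mono) auto
  finally have "\<bar>x \<bullet> dir \<theta> - x \<bullet> dir \<theta>'\<bar> \<le> \<rho> * \<bar>\<theta> - \<theta>'\<bar>" .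
  moreover have "\<bar>t - x \<bullet> dir \<theta>\<bar> \<le> \<delta>" "\<bar>t' - x \<bullet> dir \<theta>'\<bar> \<le> \<delta>"
    using x by (auto simp: rectangle_def)
  ultimately have "\<bar>t - t'\<bar> \<le> \<rho> * \<bar>\<theta> - \<theta>'\<bar> + 2 * \<delta>" by linarith
  also have "\<dots> \<le> (\<rho> + 2) * r"
    using \<delta> \<open>0 \<le> \<rho>\<close> by (simp add: r_def algebra_simps)
  finally show "\<bar>t - t'\<bar> \<le> (\<rho> + 2) * r" .
qed

section \<open>The measure of neighbourhoods\<close>

text \<open>The offsets \<open>t\<close> of the lines perpendicular to \<open>dir \<theta>\<close> on which \<open>K\<close> contains a segment of length at
least \<open>l\<close>.\<close>
definition slice :: "(real^2) set \<Rightarrow> real \<Rightarrow> real \<Rightarrow> real set" where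
  "slice K l \<theta> =
     {t. \<exists>\<alpha> \<beta>. l \<le> \<beta> - \<alpha> \<and> (\<forall>y\<in>{\<alpha>..\<beta>}. t *\<^sub>R dir \<theta> + y *\<^sub>R dir_perp \<theta> \<in> K)}"

lemma hausdorff_premeasure_image_dyadic_le:
  fixes f :: "real \<Rightarrow> 'a::metric_space"
  assumes "0 < s" and f: "\<And>x y. dist (f x) (f y) \<le> \<bar>x - y\<bar>" and B: "B \<subseteq> dyadic k j"
  shows "hausdorff_premeasure s 1 (f ` B) \<le> ennreal (((1/2) ^ k) powr s)"
proof -
  have d: "dist x y \<le> (1/2) ^ k" if "x \<in> f ` B" "y \<in> f ` B" for x y
    using that f dyadic_dist_le B by (smt (verit, best) imageE subsetD)
  have b: "bounded (f ` B)" using d unfolding bounded_two_points by blast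
  have diam: "diameter (f ` B) \<le> (1/2) ^ k"
    using d unfolding diameter_def by (auto intro!: cSUP_least)
  have "hausdorff_premeasure s 1 (f ` B) \<le> diam_power s (f ` B)"
    using diam power_le_one[of "1/2::real" k] b by (intro hausdorff_premeasure_le_diam_power) auto
  also have "\<dots> \<le> ennreal (((1/2) ^ k) powr s)"
    using diam \<open>0 < s\<close> diameter_ge_0[OF b] by (auto simp: diam_power_def intro!: ennreal_leI powr_mono2)
  finally show ?thesis .
qed

lemma frostman_hausdorff:
  fixes f :: "real \<Rightarrow> 'a::metric_space"
  assumes "0 < s" and "\<And>x y. dist (f x) (f y) \<le> \<bar>x - y\<bar>" and "A \<subseteq> dyadic 0 j"
    and "ennreal \<eta> \<le> hausdorff_premeasure s 1 (f ` A)"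
  obtains F w where "finite F" "F \<subseteq> A" "\<And>x. 0 \<le> w x" "\<eta> \<le> sum w F" "ball_growth s N F w"
proof -
  obtain F w where F: "finite F" "F \<subseteq> A" "\<And>x. 0 \<le> w x"
    "hausdorff_premeasure s 1 (f ` A) \<le> ennreal (sum w F)" "ball_growth s N F w"
  proof (rule frostman[of "\<lambda>B. hausdorff_premeasure s 1 (f ` B)" A s j N])
    show "hausdorff_premeasure s 1 (f ` (B \<union> C))
        \<le> hausdorff_premeasure s 1 (f ` B) + hausdorff_premeasure s 1 (f ` C)" for B C
      unfolding image_Un by (rule hausdorff_premeasure_subadditive) simp
    show "hausdorff_premeasure s 1 (f ` (A \<inter> dyadic k j)) \<le> ennreal (((1/2) ^ k) powr s)" for k j
      using assms by (intro hausdorff_premeasure_image_dyadic_le) auto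
  qed (use assms in \<open>auto simp: hausdorff_premeasure_empty\<close>)
  have "ennreal \<eta> \<le> ennreal (sum w F)" using assms(4) F(4) by (rule order.trans)
  then have "\<eta> \<le> sum w F" using F(3) by (simp add: ennreal_le_iff sum_nonneg)
  then show thesis using F that by blast
qed

text \<open>The \<open>L\<^sup>2\<close> estimate at the heart of the proof. Put Frostman weights \<open>\<nu>\<close> on finitely many angles in \<open>\<Theta>\<close>,
and for each such angle \<open>\<theta>\<close> Frostman weights \<open>\<mu> \<theta>\<close> on finitely many offsets in its slice, all at resolution
\<open>\<delta> = (1/2) ^ N\<close>. Each pair \<open>(\<theta>, t)\<close> gives a rectangle of area at least \<open>2 * \<delta> * l\<close> in the
\<open>\<delta>\<close>-neighbourhood of \<open>K\<close>. Fix one rectangle. For an angle at distance about \<open>r\<close>, the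
rectangles that meet it have offsets in an interval of length comparable to \<open>r\<close>, which has weight \<open>O(r powr s)\<close>, and each
overlap has area \<open>O(\<delta>\<^sup>2 / r)\<close>. The sum over the angles is therefore \<open>\<delta>\<^sup>2\<close> times a potential of \<open>\<nu>\<close> of
order \<open>1 - s\<close>, and this is bounded because \<open>u > 1 - s\<close>. The powers of \<open>\<delta>\<close> cancel in the
overlap bound, so the constant does not depend on \<open>N\<close>.\<close>
lemma thickening_measure_ge:
  fixes s u l \<eta> \<eta>' :: real
  assumes s: "0 < s" "s \<le> 1" and u: "1 - s < u" and pos: "0 < l" "0 < \<eta>" "0 < \<eta>'" and "bounded K"
    and \<Theta>: "\<Theta> \<subseteq> dyadic 0 i" and big: "ennreal \<eta> \<le> hausdorff_premeasure u 1 (dir ` \<Theta>)"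
    and slices: "\<And>\<theta>. \<theta> \<in> \<Theta> \<Longrightarrow> ennreal \<eta>' \<le> hausdorff_premeasure s 1 (slice K l \<theta> \<inter> dyadic 0 j)"
  obtains c where "0 < c"
    and "\<And>N U. U \<in> lmeasurable \<Longrightarrow> (\<Union>x\<in>K. cball x ((1/2) ^ N)) \<subseteq> U \<Longrightarrow> c \<le> measure lebesgue U"
proof -
  obtain \<rho>\<^sub>0 where \<rho>\<^sub>0: "\<And>x. x \<in> K \<Longrightarrow> norm x \<le> \<rho>\<^sub>0" "0 < \<rho>\<^sub>0"
    using \<open>bounded K\<close> by (auto simp: bounded_pos)
  define \<rho> where "\<rho> = \<rho>\<^sub>0 + 1"
  have "0 \<le> \<rho>" using \<rho>\<^sub>0 by (simp add: \<rho>_def)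
  define P where "P = 5 * 2 powr u / (1 - (1/2) powr (u - (1 - s)))"
  define C where "C = (16 + 8 * \<rho>) * 5 * (\<rho> + 2) powr s"
  have "(1/2) powr (u - (1 - s)) < 1"
    using u powr_less_mono[of 0 "u - (1 - s)" "2::real"] by (simp add: powr_divide)
  then have "0 < P" by (simp add: P_def)
  have "0 < C" using \<open>0 \<le> \<rho>\<close> by (simp add: C_def)
  show thesis
  proof (rule that[of "\<eta> * \<eta>' * (2 * l)\<^sup>2 / (C * P)"])
    show "0 < \<eta> * \<eta>' * (2 * l)\<^sup>2 / (C * P)" using pos \<open>0 < P\<close> \<open>0 < C\<close> by simp
    fix N U
    assume U: "U \<in> lmeasurable" "(\<Union>x\<in>K. cball x ((1/2) ^ N)) \<subseteq> U"
    define \<delta> where "\<delta> = (1/2 :: real) ^ N"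
    have \<delta>: "0 < \<delta>" "\<delta> \<le> 1" by (simp_all add: \<delta>_def power_le_one)
    have disc: "(\<Union>x\<in>K. cball x \<delta>) \<subseteq> cball 0 \<rho>"
    proof safe
      fix x z :: "real^2" assume x: "x \<in> K" and z: "z \<in> cball x \<delta>"
      have "norm z \<le> norm x + dist x z"
        using norm_triangle_sub[of z x] by (simp add: dist_norm norm_minus_commute)
      then show "z \<in> cball 0 \<rho>" using \<rho>\<^sub>0(1)[OF x] z \<delta> by (auto simp: \<rho>_def)
    qed
    obtain F \<nu> where F: "finite F" "F \<subseteq> \<Theta>" "\<And>\<theta>. 0 \<le> \<nu> \<theta>" "\<eta> \<le> sum \<nu> F" "ball_growth u N F \<nu>"
      using frostman_hausdorff[OF _ _ \<Theta> big] u s norm_dir_diff_le by (auto simp: dist_norm)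
    have "\<exists>G \<mu>. finite G \<and> G \<subseteq> slice K l \<theta> \<and> (\<forall>t. 0 \<le> \<mu> t) \<and> \<eta>' \<le> sum \<mu> G \<and> ball_growth s N G \<mu>"
      if "\<theta> \<in> F" for \<theta>
    proof -
      have "ennreal \<eta>' \<le> hausdorff_premeasure s 1 ((\<lambda>t. t) ` (slice K l \<theta> \<inter> dyadic 0 j))"
        using slices that F(2) by auto
      from frostman_hausdorff[OF s(1) _ Int_lower2 this, of N]
      obtain G \<mu> where "finite G" "G \<subseteq> slice K l \<theta> \<inter> dyadic 0 j" "\<And>t. 0 \<le> \<mu> t" "\<eta>' \<le> sum \<mu> G"
          "ball_growth s N G \<mu>"
        by (auto simp: dist_real_def)
      then show ?thesis by blast
    qed
    then obtain G \<mu> where G: "\<And>\<theta>. \<theta> \<in> F \<Longrightarrow> finite (G \<theta>)" "\<And>\<theta>. \<theta> \<in> F \<Longrightarrow> G \<theta> \<subseteq> slice K l \<theta>"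
      "\<And>\<theta> t. \<theta> \<in> F \<Longrightarrow> 0 \<le> \<mu> \<theta> t" "\<And>\<theta>. \<theta> \<in> F \<Longrightarrow> \<eta>' \<le> sum (\<mu> \<theta>) (G \<theta>)"
      "\<And>\<theta>. \<theta> \<in> F \<Longrightarrow> ball_growth s N (G \<theta>) (\<mu> \<theta>)"
      by metis
    have "\<exists>\<alpha> \<beta>. l \<le> \<beta> - \<alpha> \<and> (\<forall>y\<in>{\<alpha>..\<beta>}. t *\<^sub>R dir \<theta> + y *\<^sub>R dir_perp \<theta> \<in> K)"
      if "\<theta> \<in> F" "t \<in> G \<theta>" for \<theta> t
      using G(2) that by (auto simp: slice_def)
    then obtain \<alpha> \<beta> where seg: "\<And>\<theta> t. \<theta> \<in> F \<Longrightarrow> t \<in> G \<theta> \<Longrightarrow> l \<le> \<beta> \<theta> t - \<alpha> \<theta> t"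
      "\<And>\<theta> t y. \<theta> \<in> F \<Longrightarrow> t \<in> G \<theta> \<Longrightarrow> y \<in> {\<alpha> \<theta> t..\<beta> \<theta> t} \<Longrightarrow> t *\<^sub>R dir \<theta> + y *\<^sub>R dir_perp \<theta> \<in> K"
      by metis
    define I where "I = Sigma F G"
    define w where "w = (\<lambda>(\<theta>, t). \<nu> \<theta> * \<mu> \<theta> t)"
    define R where "R = (\<lambda>(\<theta>, t). rectangle \<delta> \<theta> t (\<alpha> \<theta> t) (\<beta> \<theta> t))"
    have "finite I" unfolding I_def using F(1) G(1) by auto
    have w: "0 \<le> w p" if "p \<in> I" for p using that F(3) G(3) by (auto simp: I_def w_def)
    have R_sub: "R p \<subseteq> (\<Union>x\<in>K. cball x \<delta>)" if "p \<in> I" for p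
      using that seg(2) by (auto simp: I_def R_def intro!: rectangle_subset_thickening)
    have R_U: "R p \<subseteq> U" if "p \<in> I" for p using R_sub[OF that] U(2) unfolding \<delta>_def by blast
    have \<alpha>\<beta>: "\<alpha> \<theta> t \<le> \<beta> \<theta> t" if "(\<theta>, t) \<in> I" for \<theta> t
      using that seg(1)[of \<theta> t] \<open>0 < l\<close> by (auto simp: I_def)
    have R: "R p \<in> lmeasurable" "2 * \<delta> * l \<le> measure lebesgue (R p)" if "p \<in> I" for p
      using that \<alpha>\<beta> seg(1) \<delta> by (auto simp: I_def R_def rectangle_measure intro!: mult_left_mono)
    have "(\<Sum>q\<in>I. w q * measure lebesgue (R p \<inter> R q)) \<le> C * P * \<delta>\<^sup>2" if p: "p \<in> I" for p
    proof -
      obtain \<theta> t where p_eq: "p = (\<theta>, t)" and \<theta>: "\<theta> \<in> F" "t \<in> G \<theta>" using p by (auto simp: I_def)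
      have near: "\<bar>\<theta> - \<theta>'\<bar> \<le> 1" if "\<theta>' \<in> F" for \<theta>'
        using dyadic_dist_le[of \<theta> 0 i \<theta>'] that \<theta> F(2) \<Theta> by auto
      have in_disc: "rectangle \<delta> \<theta> t (\<alpha> \<theta> t) (\<beta> \<theta> t) \<subseteq> cball 0 \<rho>"
        using R_sub[OF p] disc by (auto simp: p_eq R_def)
      have inner: "(\<Sum>t'\<in>G \<theta>'. \<mu> \<theta>' t' * measure lebesgue (R p \<inter> R (\<theta>', t')))
          \<le> C * \<delta>\<^sup>2 * (\<bar>\<theta> - \<theta>'\<bar> + \<delta>) powr (- (1 - s))" if \<theta>': "\<theta>' \<in> F" for \<theta>'
      proof -
        define r where "r = \<bar>\<theta> - \<theta>'\<bar> + \<delta>"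
        define r' where "r' = (\<rho> + 2) * r"
        have r: "0 < r" "\<delta> \<le> r" using \<delta> by (simp_all add: r_def)
        \<comment> \<open>Only offsets within \<open>r'\<close> of \<open>t\<close> contribute; the growth bound for the weights
          applies since \<open>r'\<close> is above the resolution \<open>\<delta>\<close>.\<close>
        have "1 * r \<le> r'" unfolding r'_def using r \<open>0 \<le> \<rho>\<close> by (intro mult_right_mono) auto
        then have r': "\<delta> \<le> r'" using r by simp
        have "\<mu> \<theta>' t' * measure lebesgue (R p \<inter> R (\<theta>', t'))
            \<le> (if t' \<in> {t - r'..t + r'} then \<mu> \<theta>' t' * ((16 + 8 * \<rho>) * \<delta>\<^sup>2 / r) else 0)"
          if t': "t' \<in> G \<theta>'" for t'
        proof -
          have "\<alpha> \<theta>' t' \<le> \<beta> \<theta>' t'" "\<alpha> \<theta> t \<le> \<beta> \<theta> t" using \<alpha>\<beta> \<theta> \<theta>' t' by (auto simp: I_def)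
          note ov = rectangle_overlap[OF \<delta> this(2,1) near[OF \<theta>'] in_disc \<open>0 \<le> \<rho>\<close>, of t', folded r_def]
          show ?thesis
          proof (cases "t' \<in> {t - r'..t + r'}")
            case True
            have "\<mu> \<theta>' t' * measure lebesgue (R p \<inter> R (\<theta>', t')) \<le> \<mu> \<theta>' t' * ((16 + 8 * \<rho>) * \<delta>\<^sup>2 / r)"
              using ov(1) G(3)[OF \<theta>'] by (intro mult_left_mono) (simp_all add: p_eq R_def)
            then show ?thesis using True by simp
          next
            case False
            then have "R p \<inter> R (\<theta>', t') = {}"
              using ov(2) by (force simp: p_eq R_def r'_def abs_le_iff)
            then show ?thesis using False by auto
          qed
        qed
        then have "(\<Sum>t'\<in>G \<theta>'. \<mu> \<theta>' t' * measure lebesgue (R p \<inter> R (\<theta>', t')))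
            \<le> (\<Sum>t'\<in>G \<theta>'. if t' \<in> {t - r'..t + r'} then \<mu> \<theta>' t' * ((16 + 8 * \<rho>) * \<delta>\<^sup>2 / r) else 0)"
          by (rule sum_mono)
        also have "\<dots> = sum (\<mu> \<theta>') (G \<theta>' \<inter> {t - r'..t + r'}) * ((16 + 8 * \<rho>) * \<delta>\<^sup>2 / r)"
          unfolding sum_distrib_right by (rule sum.inter_restrict[symmetric]) (use G(1) \<theta>' in auto)
        also have "\<dots> \<le> (5 * r' powr s) * ((16 + 8 * \<rho>) * \<delta>\<^sup>2 / r)"
          using G(5)[OF \<theta>'] r' \<open>0 \<le> \<rho>\<close> r by (intro mult_right_mono) (auto simp: ball_growth_def \<delta>_def)
        also have "\<dots> = C * \<delta>\<^sup>2 * (r powr s / r)"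
          using \<open>0 \<le> \<rho>\<close> r by (simp add: r'_def C_def powr_mult)
        also have "r powr s / r = r powr (- (1 - s))" using r by (simp add: powr_diff)
        finally show ?thesis by (simp add: r_def)
      qed
      have "(\<Sum>q\<in>I. w q * measure lebesgue (R p \<inter> R q))
          = (\<Sum>\<theta>'\<in>F. \<Sum>t'\<in>G \<theta>'. \<nu> \<theta>' * (\<mu> \<theta>' t' * measure lebesgue (R p \<inter> R (\<theta>', t'))))"
        unfolding I_def using F(1) G(1) by (subst sum.Sigma) (auto simp: w_def mult.assoc intro!: sum.cong)
      also have "\<dots> = (\<Sum>\<theta>'\<in>F. \<nu> \<theta>' * (\<Sum>t'\<in>G \<theta>'. \<mu> \<theta>' t' * measure lebesgue (R p \<inter> R (\<theta>', t'))))"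
        by (simp add: sum_distrib_left)
      also have "\<dots> \<le> (\<Sum>\<theta>'\<in>F. \<nu> \<theta>' * (C * \<delta>\<^sup>2 * (\<bar>\<theta> - \<theta>'\<bar> + \<delta>) powr (- (1 - s))))"
        using F(3) inner by (intro sum_mono mult_left_mono) auto
      also have "\<dots> = C * \<delta>\<^sup>2 * (\<Sum>\<theta>'\<in>F. \<nu> \<theta>' * (\<bar>\<theta> - \<theta>'\<bar> + (1/2) ^ N) powr (- (1 - s)))"
        by (simp add: sum_distrib_left \<delta>_def mult_ac)
      also have "\<dots> \<le> C * \<delta>\<^sup>2 * P"
        unfolding P_def using s u F near \<open>0 < C\<close> by (intro mult_left_mono potential_le) auto
      finally show ?thesis by (simp add: mult_ac)
    qed
    then have "sum w I * (2 * \<delta> * l)\<^sup>2 \<le> (C * P * \<delta>\<^sup>2) * measure lebesgue U"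
      using \<open>finite I\<close> w R R_U U(1) \<delta> pos \<open>0 < C\<close> \<open>0 < P\<close>
      by (intro weighted_overlap_bound[where R = R]) simp_all
    then have "\<delta>\<^sup>2 * (sum w I * (2 * l)\<^sup>2) \<le> \<delta>\<^sup>2 * (C * P * measure lebesgue U)"
      by (simp add: power_mult_distrib mult_ac)
    then have W: "sum w I * (2 * l)\<^sup>2 \<le> C * P * measure lebesgue U" using \<delta> by simp
    have "\<eta> * \<eta>' \<le> sum \<nu> F * \<eta>'" using F(4) pos by (intro mult_right_mono) auto
    also have "\<dots> \<le> (\<Sum>\<theta>\<in>F. \<nu> \<theta> * sum (\<mu> \<theta>) (G \<theta>))"
      unfolding sum_distrib_right using F(3) G(4) by (intro sum_mono mult_left_mono) auto
    also have "\<dots> = sum w I"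
      unfolding I_def w_def using F(1) G(1) by (subst sum.Sigma[symmetric]) (auto simp: sum_distrib_left)
    finally have "\<eta> * \<eta>' * (2 * l)\<^sup>2 \<le> sum w I * (2 * l)\<^sup>2" by (rule mult_right_mono) simp
    with W have "\<eta> * \<eta>' * (2 * l)\<^sup>2 \<le> C * P * measure lebesgue U" by linarith
    then show "\<eta> * \<eta>' * (2 * l)\<^sup>2 / (C * P) \<le> measure lebesgue U"
      using \<open>0 < C\<close> \<open>0 < P\<close> by (simp add: pos_divide_le_eq mult.commute)
  qed
qed

section \<open>From segment families to uniform slices\<close>

lemma slice_of_perp_segment:
  assumes "perp_segment (dir \<theta>) S" "S \<subseteq> K" "x \<in> S"
  shows "\<exists>n. proj (dir \<theta>) x \<in> slice K (1 / real (Suc n)) \<theta>"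
proof -
  obtain a b where ab: "a \<noteq> b" "S = closed_segment a b" "orthogonal (b - a) (dir \<theta>)"
    using assms(1) by (auto simp: perp_segment_def)
  define t where "t = a \<bullet> dir \<theta>"
  have bt: "b \<bullet> dir \<theta> = t" using ab(3) by (simp add: t_def orthogonal_def inner_diff_left)
  have t: "z \<bullet> dir \<theta> = t" if z: "z \<in> S" for z
  proof -
    obtain v where "z = (1 - v) *\<^sub>R a + v *\<^sub>R b" using z by (auto simp: ab(2) in_segment)
    then show ?thesis by (simp add: inner_add_left bt flip: t_def) (simp add: algebra_simps)
  qed
  define a' b' where "a' = a \<bullet> dir_perp \<theta>" and "b' = b \<bullet> dir_perp \<theta>"
  have a: "a = t *\<^sub>R dir \<theta> + a' *\<^sub>R dir_perp \<theta>"
    unfolding t_def a'_def by (rule dir_decomposition)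
  have b: "b = t *\<^sub>R dir \<theta> + b' *\<^sub>R dir_perp \<theta>"
    unfolding bt[symmetric] b'_def by (rule dir_decomposition)
  have "a' \<noteq> b'" using a b ab(1) by metis
  then obtain n where n: "1 / real (Suc n) < \<bar>b' - a'\<bar>"
    using reals_Archimedean[of "\<bar>b' - a'\<bar>"] by (auto simp: inverse_eq_divide)
  have "t *\<^sub>R dir \<theta> + y *\<^sub>R dir_perp \<theta> \<in> K" if y: "y \<in> {min a' b'..max a' b'}" for y
  proof -
    have "y \<in> closed_segment a' b'" using y by (auto simp: closed_segment_eq_real_ivl)
    then obtain v where v: "0 \<le> v" "v \<le> 1" "y = (1 - v) *\<^sub>R a' + v *\<^sub>R b'" by (auto simp: in_segment)
    have "t *\<^sub>R dir \<theta> + y *\<^sub>R dir_perp \<theta> = (1 - v) *\<^sub>R a + v *\<^sub>R b"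
      unfolding v(3) a b by (simp add: algebra_simps)
    moreover have "(1 - v) *\<^sub>R a + v *\<^sub>R b \<in> S" unfolding ab(2) in_segment using v by blast
    ultimately show ?thesis using assms(2) by auto
  qed
  then have "t \<in> slice K (1 / real (Suc n)) \<theta>"
    unfolding slice_def using n by (intro CollectI exI[of _ "min a' b'"] exI[of _ "max a' b'"]) auto
  then show ?thesis using t[OF assms(3)] by (auto simp: proj_def)
qed

theorem theorem1p2:
  fixes s :: real and K E\<^sub>0 :: "(real^2) set"
  assumes "0 < s" and "s \<le> 1"
    and "compact K"
    and "E\<^sub>0 \<subseteq> sphere 0 1"
    and "hausdorff_dim E\<^sub>0 > ennreal (1 - s)"
    and "\<And>e. e \<in> E\<^sub>0 \<Longrightarrow> \<exists>F. s_dimensional_family s e F \<and> \<Union>F \<subseteq> K"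
  shows "emeasure lebesgue K > 0"
proof (rule ccontr)
  assume "\<not> ?thesis"
  then have null: "emeasure lebesgue K = 0" by (simp add: zero_less_iff_neq_zero)
  obtain d where d: "ennreal (1 - s) < d" "d < hausdorff_dim E\<^sub>0" using dense[OF assms(5)] by blast
  then obtain u where u: "d = ennreal u" "0 \<le> u" by (cases d) auto
  have us: "1 - s < u" using d(1) u \<open>s \<le> 1\<close> by (simp add: ennreal_less_iff)
  have "hausdorff_measure u E\<^sub>0 \<noteq> 0"
  proof
    assume "hausdorff_measure u E\<^sub>0 = 0"
    then have "hausdorff_dim E\<^sub>0 \<le> ennreal u" unfolding hausdorff_dim_def using u by (intro Inf_lower) auto
    then show False using d u by simp
  qed
  then have E0: "0 < hausdorff_premeasure u 1 E\<^sub>0"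
    using us \<open>s \<le> 1\<close> by (intro hausdorff_measure_pos_imp_premeasure_pos) (auto simp: zero_less_iff_neq_zero)
  \<comment> \<open>Length, content and position of the slice are controlled by countably many choices of
    parameters, one of which must retain a set of directions of positive content.\<close>
  define good where "good n m j = {\<theta>. ennreal (1 / real (Suc m))
      \<le> hausdorff_premeasure s 1 (slice K (1 / real (Suc n)) \<theta> \<inter> dyadic 0 j)}" for n m :: nat and j :: int
  have "\<exists>n m j. \<theta> \<in> good n m j" if "dir \<theta> \<in> E\<^sub>0" for \<theta>
  proof -
    obtain \<F> where \<F>: "\<And>S. S \<in> \<F> \<Longrightarrow> perp_segment (dir \<theta>) S" "\<Union>\<F> \<subseteq> K"
      "0 < hausdorff_measure s (proj (dir \<theta>) ` \<Union>\<F>)"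
      using assms(6)[OF \<open>dir \<theta> \<in> E\<^sub>0\<close>] by (auto simp: s_dimensional_family_def)
    have "0 < hausdorff_premeasure s 1 (proj (dir \<theta>) ` \<Union>\<F>)"
      using \<F>(3) \<open>0 < s\<close> by (intro hausdorff_measure_pos_imp_premeasure_pos) auto
    also have "\<dots> \<le> hausdorff_premeasure s 1
        (\<Union>(n, j). slice K (1 / real (Suc n)) \<theta> \<inter> dyadic 0 j)"
    proof (rule hausdorff_premeasure_mono, safe)
      fix x S assume "x \<in> S" "S \<in> \<F>"
      then obtain n where "proj (dir \<theta>) x \<in> slice K (1 / real (Suc n)) \<theta>"
        using slice_of_perp_segment[of \<theta> S K x] \<F> by auto
      then show "proj (dir \<theta>) x \<in> (\<Union>(n, j). slice K (1 / real (Suc n)) \<theta> \<inter> dyadic 0 j)"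
        by (auto simp: dyadic_def)
    qed
    finally obtain p where p: "0 < hausdorff_premeasure s 1
        (case p of (n, j) \<Rightarrow> slice K (1 / real (Suc n)) \<theta> \<inter> dyadic 0 j)"
      using hausdorff_premeasure_UN_pos by blast
    obtain n j where "p = (n, j)" by fastforce
    with p have "0 < hausdorff_premeasure s 1 (slice K (1 / real (Suc n)) \<theta> \<inter> dyadic 0 j)" by simp
    then obtain \<eta> where \<eta>: "0 < \<eta>" "\<eta> < hausdorff_premeasure s 1 (slice K (1 / real (Suc n)) \<theta> \<inter> dyadic 0 j)"
      using dense by blast
    then obtain y where y: "\<eta> = ennreal y" "0 < y" by (cases \<eta>) auto
    obtain m where "1 / real (Suc m) < y" using reals_Archimedean[OF y(2)] by (auto simp: inverse_eq_divide)
    then have "ennreal (1 / real (Suc m)) \<le> \<eta>" unfolding y(1) by (intro ennreal_leI) simp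
    then show ?thesis using \<eta>(2) unfolding good_def by (blast intro: order.trans less_imp_le)
  qed
  then have "E\<^sub>0 \<subseteq> (\<Union>(i, n, m, j). dir ` (good n m j \<inter> dyadic 0 i))"
  proof safe
    fix e assume "e \<in> E\<^sub>0" and *: "\<And>\<theta>. dir \<theta> \<in> E\<^sub>0 \<Longrightarrow> \<exists>n m j. \<theta> \<in> good n m j"
    then obtain \<theta> where \<theta>: "e = dir \<theta>" using assms(4) sphere_eq_range_dir by blast
    then obtain n m j where "\<theta> \<in> good n m j" using * \<open>e \<in> E\<^sub>0\<close> by blast
    then have "e \<in> dir ` (good n m j \<inter> dyadic 0 \<lfloor>\<theta>\<rfloor>)" by (auto simp: \<theta> dyadic_def)
    then show "e \<in> (\<Union>(i, n, m, j). dir ` (good n m j \<inter> dyadic 0 i))" by blast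
  qed
  then have "0 < hausdorff_premeasure u 1 (\<Union>(i, n, m, j). dir ` (good n m j \<inter> dyadic 0 i))"
    using E0 by (meson hausdorff_premeasure_mono less_le_trans)
  then obtain p where p: "0 < hausdorff_premeasure u 1
      (case p of (i, n, m, j) \<Rightarrow> dir ` (good n m j \<inter> dyadic 0 i))"
    by (rule hausdorff_premeasure_UN_pos)
  obtain i n m j where "p = (i, n, m, j)" by (cases p) auto
  with p have pos: "0 < hausdorff_premeasure u 1 (dir ` (good n m j \<inter> dyadic 0 i))" by simp
  obtain \<eta> where \<eta>: "0 < \<eta>" "ennreal \<eta> \<le> hausdorff_premeasure u 1 (dir ` (good n m j \<inter> dyadic 0 i))"
  proof -
    obtain z where z: "0 < z" "z < hausdorff_premeasure u 1 (dir ` (good n m j \<inter> dyadic 0 i))"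
      using dense[OF pos] by blast
    then show thesis using that[of "enn2real z"] by (cases z) auto
  qed
  obtain c where c: "0 < c"
    and ge: "\<And>N U. U \<in> lmeasurable \<Longrightarrow> (\<Union>x\<in>K. cball x ((1/2) ^ N)) \<subseteq> U \<Longrightarrow> c \<le> measure lebesgue U"
    by (rule thickening_measure_ge[OF assms(1,2) us _ \<eta>(1) _ compact_imp_bounded[OF \<open>compact K\<close>] Int_lower2 \<eta>(2),
          of "1 / real (Suc n)" "1 / real (Suc m)" j]) (auto simp: good_def)
  have "K \<in> sets lebesgue" using \<open>compact K\<close> by (simp add: lmeasurable_compact fmeasurableD)
  then obtain T where T: "open T" "K \<subseteq> T" "(T - K) \<in> lmeasurable" "emeasure lebesgue (T - K) < ennreal c"
    using sets_lebesgue_outer_open \<open>0 < c\<close> by blast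
  \<comment> \<open>Being null, \<open>K\<close> has an open neighbourhood of measure below \<open>c\<close>, which contains a
    thickening of \<open>K\<close> by compactness.\<close>
  have KT: "T = (T - K) \<union> K" using T(2) by auto
  have lmT: "T \<in> lmeasurable"
    using T(3) lmeasurable_compact[OF \<open>compact K\<close>] by (subst KT) (rule fmeasurable.Un)
  have "emeasure lebesgue ((T - K) \<union> K) \<le> emeasure lebesgue (T - K) + emeasure lebesgue K"
    using T(3)[THEN fmeasurableD] \<open>K \<in> sets lebesgue\<close> by (rule emeasure_subadditive)
  also have "\<dots> < ennreal c" using T(4) null by simp
  finally have small: "measure lebesgue T < c"
    using lmT c unfolding KT[symmetric] by (simp add: emeasure_eq_measure2 ennreal_less_iff)
  obtain \<epsilon> where \<epsilon>: "0 < \<epsilon>" "(\<Union>x\<in>K. cball x \<epsilon>) \<subseteq> T"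
    using compact_subset_open_imp_cball_epsilon_subset[OF \<open>compact K\<close> T(1,2)] by blast
  obtain N where N: "(1/2) ^ N < \<epsilon>" using real_arch_pow_inv[OF \<epsilon>(1)] by force
  have "c \<le> measure lebesgue T"
    by (rule ge[OF lmT, of N]) (use \<epsilon>(2) N in fastforce)
  then show False using small by simp
qed

end
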